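(* Consider the procedure $\mathrm{Collect}$ described in the context, and assume all its sub-routines ($\mathrm{Check}$, $\mathrm{Eval}$, $\mathrm{Cube}$, and the selection of cubes and strategies) terminate. Assume that the cubing procedure $\mathrm{Cube}(\cdot,k)$ satisfies the following bounded cost reduction property with respect to the set of strategies $\mathcal{S}$ and the maximal cost $c_{\max}$: for any formula $F$, every cubing trace starting from $F$ with respect to $\mathrm{Cube}(\cdot,k)$ reaches, in a finite number of steps, a cube $c$ such that $\max_{s\in\mathcal{S}}\mathrm{Eval}(F\wedge c,s)<c_{\max}$. Then for every formula $F$, finite set of cubes $\mathcal{C}$ and $N\in\mathbb{N}$, $\mathrm{Collect}(F,\mathcal{C},N,\mathcal{S})$ terminates.
   Context: A cube is a conjunction of literals (constraints). For a formula $F$, a solving strategy $s$ and a cost budget $B$, $\mathrm{Eval}(F,s)$ denotes the cost of solving $F$ with strategy $s$, and $\mathrm{Check}(F,s,B)$ attempts to solve $F$ with $s$ under budget $B$: if $\mathrm{Eval}(F,s)\le B$ it returns the correct answer SAT or UNSAT, and otherwise it returns UNKNOWN. $\mathrm{Cube}(F,k)$ partitions $F$ into $k$ cubes. A cubing trace starting from a formula $F$ with respect to $\mathrm{Cube}(\cdot,k)$ is a sequence of cubes $c_0,c_1,\dots$ with $c_0=\top$ and $c_{i+1}\in\mathrm{Cube}(F\wedge c_i,k)$; the trace reaches $c_i$ in $i$ steps. The procedure $\mathrm{Collect}(F,\mathcal{C},N,\mathcal{S})$ (parameters: $k>1$, minimal cost $c_{\min}$, maximal cost $c_{\max}$) works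 as follows: set $\mathcal{C}^*:=\emptyset$. While $|\mathcal{C}^*|<N$: pick some cube $c\in\mathcal{C}$ and some strategy $s\in\mathcal{S}$; let $r:=\mathrm{Check}(F\wedge c,s,c_{\max})$. If $r=$ SAT, return $\langle\mathrm{SAT},\emptyset\rangle$. Else if $r=$ UNSAT and $\mathrm{Eval}(F\wedge c,s)\ge c_{\min}$, set $\mathcal{C}^*:=\mathcal{C}^*\cup\{c\}$. Else if $r=$ UNKNOWN, set $\mathcal{C}:=\mathcal{C}\cup\{c'\wedge c : c'\in\mathrm{Cube}(F\wedge c,k)\}$. Then remove $c$ from $\mathcal{C}$; if $\mathcal{C}$ is empty, return $\langle\mathrm{UNSAT},\emptyset\rangle$. When the while loop exits, return $\langle\mathrm{UNKNOWN},\mathcal{C}^*\rangle$.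
   Formalization: Cubing traces accumulate: c_{i+1} = c' ∧ c_i with c' in Cube(F ∧ c_i, k), as in Collect; with the printed c_{i+1} in Cube(F ∧ c_i, k) the claim is false. S is finite and nonempty, and formulas are identified up to associativity, commutativity and idempotence of conjunction. *)

theory Defs
  imports Complex_Main "HOL-Library.FSet"
begin

text \<open>
  A formula is a finite conjunction of constraints, represented by the finite set of its conjuncts,
  so that conjunction is union, the empty set is \<open>\<top>\<close>, and formulas are identified up to
  associativity, commutativity and idempotence of conjunction. Nothing is assumed about constraints,
  so any formula whatsoever may occur as a single conjunct.
\<close>

type_synonym 'a formula = "'a fset"
type_synonym 'a cube = "'a fset"

definition is_cube :: "'a set \<Rightarrow> 'a cube \<Rightarrow> bool" where
  "is_cube lits c \<longleftrightarrow> fset c \<subseteq> lits"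

abbreviation conjoin :: "'a fset \<Rightarrow> 'a fset \<Rightarrow> 'a fset" where
  "conjoin F c \<equiv> F |\<union>| c"

text \<open>\<open>models m a\<close>: the interpretation \<open>m\<close> satisfies the constraint \<open>a\<close>.\<close>

definition satisfies :: "('m \<Rightarrow> 'a \<Rightarrow> bool) \<Rightarrow> 'm \<Rightarrow> 'a formula \<Rightarrow> bool" where
  "satisfies models m F \<longleftrightarrow> (\<forall>a. a |\<in>| F \<longrightarrow> models m a)"

definition satisfiable :: "('m \<Rightarrow> 'a \<Rightarrow> bool) \<Rightarrow> 'a formula \<Rightarrow> bool" where
  "satisfiable models F \<longleftrightarrow> (\<exists>m. satisfies models m F)"

datatype answer = SAT | UNSAT | UNKNOWN

definition check ::
  "('m \<Rightarrow> 'a \<Rightarrow> bool) \<Rightarrow> ('a formula \<Rightarrow> 's \<Rightarrow> real) \<Rightarrow> 'a formula \<Rightarrow> 's \<Rightarrow> real \<Rightarrow> answer" where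
  "check models Eval F s B =
     (if Eval F s \<le> B then (if satisfiable models F then SAT else UNSAT) else UNKNOWN)"

text \<open>\<open>P\<close> splits \<open>F\<close> into \<open>k\<close> mutually exclusive cubes that together cover all models of \<open>F\<close>.\<close>

definition partitions_into ::
  "('m \<Rightarrow> 'a \<Rightarrow> bool) \<Rightarrow> 'a set \<Rightarrow> 'a formula \<Rightarrow> nat \<Rightarrow> 'a cube set \<Rightarrow> bool" where
  "partitions_into models lits F k P \<longleftrightarrow>
     finite P \<and> card P = k \<and> (\<forall>c\<in>P. is_cube lits c) \<and>
     (\<forall>m. satisfies models m F \<longrightarrow> (\<exists>!c. c \<in> P \<and> satisfies models m c))"

text \<open>
  The cubes of a trace accumulate the decisions made so far, in the same way as the cubes
  \<open>c' \<and> c\<close> that \<open>Collect\<close> generates. If \<open>Cube\<close> returns cubes that already extend \<open>c i\<close>, the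
  successor condition is just \<open>c (Suc i) \<in> Cube (F \<and> c i) k\<close>.
\<close>

definition cubing_trace ::
  "('a formula \<Rightarrow> nat \<Rightarrow> 'a cube set) \<Rightarrow> nat \<Rightarrow> 'a formula \<Rightarrow> (nat \<Rightarrow> 'a cube) \<Rightarrow> bool" where
  "cubing_trace Cube k F c \<longleftrightarrow>
     c 0 = {||} \<and> (\<forall>i. \<exists>c'\<in>Cube (conjoin F (c i)) k. c (Suc i) = conjoin c' (c i))"

definition bounded_cost_reduction ::
  "('a formula \<Rightarrow> 's \<Rightarrow> real) \<Rightarrow> ('a formula \<Rightarrow> nat \<Rightarrow> 'a cube set) \<Rightarrow> nat \<Rightarrow> 's set \<Rightarrow> real \<Rightarrow> bool" where
  "bounded_cost_reduction Eval Cube k S c_max \<longleftrightarrow>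
     (\<forall>F c. cubing_trace Cube k F c \<longrightarrow>
        (\<exists>i. Max ((\<lambda>s. Eval (conjoin F (c i)) s) ` S) < c_max))"

text \<open>
  Small-step semantics of \<open>Collect\<close>. \<open>Loop C Cs\<close> is the state at the loop head, with \<open>Cs\<close> the
  collected set \<open>C\<^sup>*\<close>; one step is one execution of the loop body, or the exit from the loop. The
  selection of the cube and of the strategy is nondeterministic. The sub-routines terminate, so they
  are total functions.
\<close>

datatype 'a config = Loop "'a cube set" "'a cube set" | Return answer "'a cube set"

inductive collect_step ::
  "('m \<Rightarrow> 'a \<Rightarrow> bool) \<Rightarrow> ('a formula \<Rightarrow> 's \<Rightarrow> real) \<Rightarrow> ('a formula \<Rightarrow> nat \<Rightarrow> 'a cube set) \<Rightarrow>
   nat \<Rightarrow> real \<Rightarrow> real \<Rightarrow> 'a formula \<Rightarrow> nat \<Rightarrow> 's set \<Rightarrow> 'a config \<Rightarrow> 'a config \<Rightarrow> bool"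
  for models Eval Cube k c_min c_max F N S where
  exit: "\<not> card Cs < N \<Longrightarrow>
    collect_step models Eval Cube k c_min c_max F N S (Loop C Cs) (Return UNKNOWN Cs)"
| sat: "\<lbrakk>card Cs < N; c \<in> C; s \<in> S; check models Eval (conjoin F c) s c_max = SAT\<rbrakk> \<Longrightarrow>
    collect_step models Eval Cube k c_min c_max F N S (Loop C Cs) (Return SAT {})"
| iterate: "\<lbrakk>card Cs < N; c \<in> C; s \<in> S;
     r = check models Eval (conjoin F c) s c_max; r \<noteq> SAT;
     Cs' = (if r = UNSAT \<and> Eval (conjoin F c) s \<ge> c_min then Cs \<union> {c} else Cs);
     C' = (if r = UNKNOWN then C \<union> {conjoin c' c |c'. c' \<in> Cube (conjoin F c) k} else C) - {c}\<rbrakk> \<Longrightarrow>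
    collect_step models Eval Cube k c_min c_max F N S (Loop C Cs)
      (if C' = {} then Return UNSAT {} else Loop C' Cs')"

text \<open>
  Termination: no sequence of selections leads to an infinite execution. An execution can only
  end without returning if there is no cube to pick, which by \<open>collect_progress\<close> and
  \<open>collect_step_nonempty\<close> is possible only if the initial set of cubes is empty.
\<close>

definition collect_terminates ::
  "('m \<Rightarrow> 'a \<Rightarrow> bool) \<Rightarrow> ('a formula \<Rightarrow> 's \<Rightarrow> real) \<Rightarrow> ('a formula \<Rightarrow> nat \<Rightarrow> 'a cube set) \<Rightarrow>
   nat \<Rightarrow> real \<Rightarrow> real \<Rightarrow> 'a formula \<Rightarrow> 'a cube set \<Rightarrow> nat \<Rightarrow> 's set \<Rightarrow> bool" where
  "collect_terminates models Eval Cube k c_min c_max F C N S \<longleftrightarrow>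
     \<not> (\<exists>\<sigma>. \<sigma> 0 = Loop C {} \<and>
           (\<forall>i. collect_step models Eval Cube k c_min c_max F N S (\<sigma> i) (\<sigma> (Suc i))))"

lemma collect_progress:
  assumes "C \<noteq> {}" "S \<noteq> {}"
  shows "\<exists>cfg. collect_step models Eval Cube k c_min c_max F N S (Loop C Cs) cfg"
proof -
  obtain c s where "c \<in> C" "s \<in> S" using assms by blast
  then show ?thesis
    by (cases "card Cs < N"; cases "check models Eval (conjoin F c) s c_max = SAT")
      (blast intro: collect_step.intros)+
qed

lemma collect_step_nonempty:
  "collect_step models Eval Cube k c_min c_max F N S cfg (Loop C Cs) \<Longrightarrow> C \<noteq> {}"
  by (erule collect_step.cases) (auto split: if_splits)

end

(* Only cubes that are too costly for some strategy are split, and by bounded cost reduction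
   (applied to F conjoined with the cube at which a chain of splits starts) no infinite chain of
   such splits exists. Every iteration replaces one cube in the work set by finitely many cubes
   below it in this well-founded order, so the work set decreases in the multiset extension. *)

theory Submission imports Defs "HOL-Library.Multiset" begin

text \<open>Pairs are (child, parent), so that well-foundedness forbids infinite chains of splits.
  The strict bound \<open>c_max < Eval\<close> is exactly the condition under which
  \<open>check\<close> with budget \<open>c_max\<close> answers \<open>UNKNOWN\<close>.\<close>

definition split_rel ::
  "('a formula \<Rightarrow> 's \<Rightarrow> real) \<Rightarrow> ('a formula \<Rightarrow> nat \<Rightarrow> 'a cube set) \<Rightarrow>
   nat \<Rightarrow> real \<Rightarrow> 'a formula \<Rightarrow> 's set \<Rightarrow> ('a cube \<times> 'a cube) set" where
  "split_rel Eval Cube k c_max F S =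
     {(conjoin c' c, c) |c' c.
        c' \<in> Cube (conjoin F c) k \<and> (\<exists>s\<in>S. c_max < Eval (conjoin F c) s)}"

text \<open>An infinite chain of splits would give a cubing trace on which every cube is too costly
  for some strategy, while the reduction property yields a point where the maximum over
  \<open>S\<close> is below \<open>c_max\<close>.\<close>

lemma wf_split_rel:
  assumes "finite S" and bcr: "bounded_cost_reduction Eval Cube k S c_max"
  shows "wf (split_rel Eval Cube k c_max F S)"
  unfolding wf_iff_no_infinite_down_chain
proof
  assume "\<exists>d. \<forall>i. (d (Suc i), d i) \<in> split_rel Eval Cube k c_max F S"
  then obtain d where "\<forall>i. (d (Suc i), d i) \<in> split_rel Eval Cube k c_max F S" ..
  then have "\<forall>i. \<exists>c'. d (Suc i) = conjoin c' (d i) \<and> c' \<in> Cube (conjoin F (d i)) k"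
    and costly: "\<And>i. \<exists>s\<in>S. c_max < Eval (conjoin F (d i)) s"
    unfolding split_rel_def by blast+
  then obtain g where g: "\<And>i. d (Suc i) = conjoin (g i) (d i)"
      "\<And>i. g i \<in> Cube (conjoin F (d i)) k"
    by metis
  \<comment> \<open>A trace must begin at the empty cube, but \<open>d 0\<close> is arbitrary. Hence
    \<open>e\<close> accumulates only the choices made after \<open>d 0\<close>, and
    \<open>d 0\<close> itself is moved into the formula.\<close>
  define e where "e = rec_nat {||} (\<lambda>i. conjoin (g i))"
  have e: "e 0 = {||}" "\<And>i. e (Suc i) = conjoin (g i) (e i)"
    by (simp_all add: e_def)
  have d_eq: "conjoin F (d i) = conjoin (conjoin F (d 0)) (e i)" for i
    by (induction i) (auto simp: e g(1))
  have "cubing_trace Cube k (conjoin F (d 0)) e"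
    unfolding cubing_trace_def d_eq[symmetric] using g(2) e by blast
  then obtain i where "Max ((\<lambda>s. Eval (conjoin (conjoin F (d 0)) (e i)) s) ` S) < c_max"
    using bcr unfolding bounded_cost_reduction_def by blast
  then have "Max ((\<lambda>s. Eval (conjoin F (d i)) s) ` S) < c_max"
    by (simp only: d_eq[of i])
  moreover obtain s where "s \<in> S" "c_max < Eval (conjoin F (d i)) s"
    using costly by blast
  moreover from \<open>s \<in> S\<close> have "Eval (conjoin F (d i)) s \<le> Max ((\<lambda>s. Eval (conjoin F (d i)) s) ` S)"
    using \<open>finite S\<close> by simp
  ultimately show False by linarith
qed

text \<open>Elements of \<open>D\<close> already in \<open>C\<close> add nothing to the union, so
  the multiset loses \<open>c\<close> and gains only \<open>D - C\<close>, all of it below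
  \<open>c\<close>.\<close>

lemma mset_set_replace_mult1:
  assumes "finite C" "finite D" "c \<in> C" "\<And>d. d \<in> D \<Longrightarrow> (d, c) \<in> r"
  shows "(mset_set (C \<union> D - {c}), mset_set C) \<in> mult1 r"
proof -
  have "C \<union> D - {c} = (C - {c}) \<union> (D - C)"
    using \<open>c \<in> C\<close> by blast
  then have "mset_set (C \<union> D - {c}) = mset_set (C - {c}) + mset_set (D - C)"
    using assms(1,2) by (simp only:) (subst mset_set_Union; auto)
  moreover have "mset_set C = add_mset c (mset_set (C - {c}))"
    using assms(1,3) by (rule mset_set.remove)
  moreover have "(d, c) \<in> r" if "d \<in># mset_set (D - C)" for d
    using that assms(2,4) by simp
  ultimately show ?thesis
    by (intro mult1I)
qed

text \<open>With \<open>UNKNOWN\<close>, the picked cube is replaced by its children in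
  \<open>split_rel\<close>; with \<open>UNSAT\<close> it is replaced by nothing. Both are one step
  of \<open>mult1\<close>.\<close>

lemma collect_step_Loop_decreases:
  assumes "collect_step models Eval Cube k c_min c_max F N S (Loop C Cs) (Loop C' Cs')"
    and "finite C" and fin: "\<And>G. finite (Cube G k)"
  shows "finite C' \<and> (mset_set C', mset_set C) \<in> mult1 (split_rel Eval Cube k c_max F S)"
  using assms(1)
proof cases
  case (iterate c s r Cs'' C'')
  define D where
    "D = (if r = UNKNOWN then {conjoin c' c |c'. c' \<in> Cube (conjoin F c) k} else {})"
  have C': "C' = C \<union> D - {c}"
    using iterate by (auto simp: D_def split: if_splits)
  have "finite D"
    using fin by (simp add: D_def)
  moreover have "(d, c) \<in> split_rel Eval Cube k c_max F S" if "d \<in> D" for d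
  proof -
    from that have "r = UNKNOWN"
      by (simp add: D_def split: if_splits)
    then have "c_max < Eval (conjoin F c) s"
      using iterate by (auto simp: check_def split: if_splits)
    then show ?thesis
      using that \<open>r = UNKNOWN\<close> \<open>s \<in> S\<close> by (auto simp: D_def split_rel_def)
  qed
  ultimately show ?thesis
    unfolding C' using \<open>finite C\<close> \<open>c \<in> C\<close> by (simp add: mset_set_replace_mult1)
qed

lemma collect_terminates_if_wf:
  assumes wf: "wf (split_rel Eval Cube k c_max F S)"
    and fin: "\<And>G. finite (Cube G k)" and "finite C"
  shows "collect_terminates models Eval Cube k c_min c_max F C N S"
  unfolding collect_terminates_def
proof
  assume "\<exists>\<sigma>. \<sigma> 0 = Loop C {} \<and>
    (\<forall>i. collect_step models Eval Cube k c_min c_max F N S (\<sigma> i) (\<sigma> (Suc i)))"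
  then obtain \<sigma> where \<sigma>0: "\<sigma> 0 = Loop C {}"
    and step: "\<And>i. collect_step models Eval Cube k c_min c_max F N S (\<sigma> i) (\<sigma> (Suc i))"
    by blast
  \<comment> \<open>Every configuration of an infinite execution has a successor, and no rule starts
    from a \<open>Return\<close>.\<close>
  have "\<exists>W Ws. \<sigma> i = Loop W Ws" for i
    using step[of i] by cases auto
  then obtain W Ws where \<sigma>: "\<And>i. \<sigma> i = Loop (W i) (Ws i)"
    by metis
  note decreases = collect_step_Loop_decreases[OF step[unfolded \<sigma>] _ fin]
  \<comment> \<open>Finiteness has to be carried along the execution, since \<open>mset_set\<close>
    of an infinite set is the empty multiset and would measure nothing.\<close>
  have "finite (W i)" for i
    by (induction i) (use \<sigma>0 \<sigma>[of 0] \<open>finite C\<close> decreases in auto)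
  then have "(mset_set (W (Suc i)), mset_set (W i)) \<in> mult1 (split_rel Eval Cube k c_max F S)" for i
    using decreases by blast
  then show False
    using wf_mult1[OF wf] unfolding wf_iff_no_infinite_down_chain
    by (elim notE) (rule exI[where x = "\<lambda>i. mset_set (W i)"], simp)
qed

theorem theorem3:
  fixes models :: "'m \<Rightarrow> 'a \<Rightarrow> bool"
    and lits :: "'a set"
    and Eval :: "'a formula \<Rightarrow> 's \<Rightarrow> real"
    and Cube :: "'a formula \<Rightarrow> nat \<Rightarrow> 'a cube set"
    and S :: "'s set"
    and k :: nat
    and c_min c_max :: real
  assumes "k > 1"
    and "finite S" and "S \<noteq> {}"
    and "\<And>F. partitions_into models lits F k (Cube F k)"
    and "bounded_cost_reduction Eval Cube k S c_max"
  shows "\<forall>(F :: 'a formula) (C :: 'a cube set) (N :: nat).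
    finite C \<and> (\<forall>c\<in>C. is_cube lits c) \<longrightarrow>
    collect_terminates models Eval Cube k c_min c_max F C N S"
proof (intro allI impI)
  fix F :: "'a formula" and C :: "'a cube set" and N :: nat
  assume "finite C \<and> (\<forall>c\<in>C. is_cube lits c)"
  moreover have "finite (Cube G k)" for G
    using assms(4)[of G] by (simp add: partitions_into_def)
  ultimately show "collect_terminates models Eval Cube k c_min c_max F C N S"
    using wf_split_rel[OF assms(2,5)] by (intro collect_terminates_if_wf) simp_all
qed

end
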